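(* Let $h_{3,4}:\mathbb{T}^3\times\mathbb{T}^4\to\mathbb{H}^3\simeq\mathbb{R}^{12}$ be the map $$h_{3,4}(x,y)=\bigl(\varphi(x)\,v_1(t)e^{y_1i},\;\varphi(x)\,v_2(t)e^{y_2i},\;\varphi(x)\,v_3(t)e^{y_3i}\bigr),\qquad x=(x_1,x_2,x_3),\ y=(y_1,y_2,y_3,t),$$ where $\varphi:\mathbb{T}^3\to\mathbb{H}$ is $$\varphi(x_1,x_2,x_3)=(2+\cos x_3)\,e^{x_1i}+(2+\sin x_3)\,e^{x_2i}j$$ and $v_1,v_2,v_3:\mathbb{S}^1\to\mathbb{H}$ are the explicit smooth loops defined in the context. Then $h_{3,4}$ has everywhere invertible mixed Hessian, namely $h_{3,4}\in P_{3,4}$.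
   Context: $\mathbb{T}^m=\mathbb{R}^m/2\pi\mathbb{Z}^m$ and $\mathbb{S}^1=\mathbb{R}/2\pi\mathbb{Z}$. $\mathbb{H}$ denotes the quaternions, identified with $\mathbb{R}^4$ via $(a_0,a_1,a_2,a_3)\mapsto a_0+a_1i+a_2j+a_3k$; $\mathrm{Im}\,\mathbb{H}\simeq\mathbb{R}^3$ (basis $i,j,k$) are the imaginary quaternions; $\langle a,b\rangle=\mathrm{Re}(a\bar b)$ is the Euclidean product; $e^{xi}=\cos x+i\sin x$. For $\xi\in\mathrm{Im}\,\mathbb{H}$ put $\rho=|\xi|$, $\xi_1=\langle\xi,i\rangle$, and, when $\rho+\xi_1>0$, set $\sigma(\xi)=\dfrac{\rho-\xi i}{\sqrt{2(\rho+\xi_1)}}\in\mathbb{H}$ (quaternionic product $\xi i$). Let $\Gamma_1,\Gamma_2,\Gamma_3:\mathbb{S}^1\to\mathrm{Im}\,\mathbb{H}\simeq\mathbb{R}^3$ be the rows of $$\Gamma(t)=\begin{pmatrix}\sin t&\tfrac16\cos3t-\tfrac12\cos t&\tfrac12\sin t-\tfrac16\sin3t\\-\cos t&\tfrac12\sin t+\tfrac16\sin3t&\tfrac12\cos t+\tfrac16\cos3t\\0&-\tfrac12\cos2t&\tfrac12\sin2t\end{pmatrix},$$ and set $F_r(t)=3i+2\Gamma_r(t)$ and $v_r(t)=\sigma(F_r(t))$, $r=1,2,3$ (each $F_r(t)$ lies in the region $\rho+\xi_1>0$). A $C^\infty$ map $h:\mathbb{T}^a\times\mathbb{T}^b\to\mathbb{R}^{ab}$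 has invertible mixed Hessian at a point if the $ab$ vectors $\frac{\partial^2h}{\partial x_i\partial y_\alpha}$ ($x_i$ the coordinates on $\mathbb{T}^a$, $y_\alpha$ those on $\mathbb{T}^b$) form a basis of $\mathbb{R}^{ab}$ at that point; $P_{a,b}$ is the set of all such $h$ for which this holds at every point. Here the coordinates on $\mathbb{T}^3$ are $(x_1,x_2,x_3)$ and those on $\mathbb{T}^4$ are $(y_1,y_2,y_3,y_4)$ with $y_4=t$. *)

theory Defs
  imports "HOL-Analysis.Analysis"
begin

subsection \<open>Quaternions\<close>

text \<open>Quaternions are vectors in \<^typ>\<open>real^4\<close>: the quaternion $a_0 + a_1 i + a_2 j + a_3 k$ has
  $a_0, \ldots, a_3$ as its entries at the indices 1, 2, 3, 4. Addition, real scaling, norm and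
  inner product are those of \<^typ>\<open>real^4\<close>. Note that \<open>*\<close> on \<^typ>\<open>real^4\<close> is the componentwise product
  and \<open>1\<close> its all-ones vector; neither is the quaternionic one.\<close>

type_synonym quat = "real^4"

definition quat :: "real \<Rightarrow> real \<Rightarrow> real \<Rightarrow> real \<Rightarrow> quat" where
  "quat a0 a1 a2 a3 = (\<chi> m. if m = 1 then a0 else if m = 2 then a1 else if m = 3 then a2 else a3)"

definition qmult :: "quat \<Rightarrow> quat \<Rightarrow> quat"  (infixl "\<odot>" 70) where
  "a \<odot> b = quat
     (a$1 * b$1 - a$2 * b$2 - a$3 * b$3 - a$4 * b$4)
     (a$1 * b$2 + a$2 * b$1 + a$3 * b$4 - a$4 * b$3)
     (a$1 * b$3 - a$2 * b$4 + a$3 * b$1 + a$4 * b$2)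
     (a$1 * b$4 + a$2 * b$3 - a$3 * b$2 + a$4 * b$1)"

definition quat_of_real :: "real \<Rightarrow> quat" where
  "quat_of_real r = quat r 0 0 0"

definition qi :: quat where "qi = quat 0 1 0 0"
definition qj :: quat where "qj = quat 0 0 1 0"
definition qk :: quat where "qk = quat 0 0 0 1"

definition qexp_i :: "real \<Rightarrow> quat" where
  "qexp_i x = quat_of_real (cos x) + sin x *\<^sub>R qi"

definition imag_quat :: "real^3 \<Rightarrow> quat" where
  "imag_quat u = u$1 *\<^sub>R qi + u$2 *\<^sub>R qj + u$3 *\<^sub>R qk"

lemma quat_nth [simp]:
  "quat a0 a1 a2 a3 $ 1 = a0" "quat a0 a1 a2 a3 $ 2 = a1"
  "quat a0 a1 a2 a3 $ 3 = a2" "quat a0 a1 a2 a3 $ 4 = a3"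
  by (simp_all add: quat_def)

lemma quat_eq_iff: "(a::quat) = b \<longleftrightarrow> a$1 = b$1 \<and> a$2 = b$2 \<and> a$3 = b$3 \<and> a$4 = b$4"
  by (auto simp: vec_eq_iff forall_4)

lemma qunit_mult:
  "qi \<odot> qi = quat_of_real (- 1)" "qj \<odot> qj = quat_of_real (- 1)" "qk \<odot> qk = quat_of_real (- 1)"
  "qi \<odot> qj = qk" "qj \<odot> qk = qi" "qk \<odot> qi = qj"
  "qj \<odot> qi = - qk" "qk \<odot> qj = - qi" "qi \<odot> qk = - qj"
  by (simp_all add: quat_eq_iff qmult_def quat_of_real_def qi_def qj_def qk_def)

subsection \<open>Maps on tori with invertible mixed Hessian\<close>

text \<open>A map on the torus $\mathbb{R}^m / 2\pi\mathbb{Z}^m$ is represented by its lift, a function on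
  $\mathbb{R}^m$ that is invariant under translations by $2\pi\mathbb{Z}^m$; smoothness and partial
  derivatives are those of the lift.\<close>

definition torus_periodic :: "((real^'a) \<times> (real^'b) \<Rightarrow> 'c) \<Rightarrow> bool" where
  "torus_periodic h \<longleftrightarrow>
     (\<forall>x y (m :: int^'a) (n :: int^'b).
        h (x + (\<chi> i. 2 * pi * of_int (m$i)), y + (\<chi> j. 2 * pi * of_int (n$j))) = h (x, y))"

primrec times_cont_diff :: "nat \<Rightarrow> ('v::real_normed_vector \<Rightarrow> 'w::real_normed_vector) \<Rightarrow> bool" where
  "times_cont_diff 0 f \<longleftrightarrow> continuous_on UNIV f"
| "times_cont_diff (Suc n) f \<longleftrightarrow>
     (\<forall>p. f differentiable (at p)) \<and>
     (\<forall>v. times_cont_diff n (\<lambda>p. frechet_derivative f (at p) v))"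

definition smooth :: "('v::real_normed_vector \<Rightarrow> 'w::real_normed_vector) \<Rightarrow> bool" where
  "smooth f \<longleftrightarrow> (\<forall>n. times_cont_diff n f)"

definition partial_x ::
    "'a::finite \<Rightarrow> ((real^'a) \<times> (real^'b) \<Rightarrow> 'c::real_normed_vector)
      \<Rightarrow> (real^'a) \<times> (real^'b) \<Rightarrow> 'c" where
  "partial_x i f = (\<lambda>(x, y). vector_derivative (\<lambda>s. f (x + s *\<^sub>R axis i 1, y)) (at 0))"

definition partial_y ::
    "'b::finite \<Rightarrow> ((real^'a) \<times> (real^'b) \<Rightarrow> 'c::real_normed_vector)
      \<Rightarrow> (real^'a) \<times> (real^'b) \<Rightarrow> 'c" where
  "partial_y j f = (\<lambda>(x, y). vector_derivative (\<lambda>s. f (x, y + s *\<^sub>R axis j 1)) (at 0))"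

definition basis_family :: "('i \<Rightarrow> 'c::real_vector) \<Rightarrow> bool" where
  "basis_family b \<longleftrightarrow> inj b \<and> independent (range b) \<and> span (range b) = UNIV"

definition invertible_mixed_hessian ::
    "((real^'a) \<times> (real^'b) \<Rightarrow> 'c::euclidean_space) \<Rightarrow> (real^'a) \<times> (real^'b) \<Rightarrow> bool" where
  "invertible_mixed_hessian h p \<longleftrightarrow> basis_family (\<lambda>(i, j). partial_x i (partial_y j h) p)"

text \<open>The target is any Euclidean space \<open>'c\<close>; a basis indexed by the pairs \<open>(i, j)\<close> can only exist
  if \<open>DIM('c) = CARD('a) * CARD('b)\<close>.\<close>

definition P_maps :: "((real^'a) \<times> (real^'b) \<Rightarrow> 'c::euclidean_space) set" where
  "P_maps = {h. torus_periodic h \<and> smooth h \<and> (\<forall>p. invertible_mixed_hessian h p)}"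

subsection \<open>The map $h_{3,4}$\<close>

text \<open>Only meaningful where \<open>norm \<xi> + \<xi> \<bullet> qi > 0\<close>.\<close>

definition sigma :: "quat \<Rightarrow> quat" where
  "sigma \<xi> = (let \<rho> = norm \<xi>; \<xi>1 = \<xi> \<bullet> qi
             in (quat_of_real \<rho> - \<xi> \<odot> qi) /\<^sub>R sqrt (2 * (\<rho> + \<xi>1)))"

definition Gamma_rows :: "real \<Rightarrow> real^3^3" where
  "Gamma_rows t = vector [
     vector [sin t, cos (3*t) / 6 - cos t / 2, sin t / 2 - sin (3*t) / 6],
     vector [- cos t, sin t / 2 + sin (3*t) / 6, cos t / 2 + cos (3*t) / 6],
     vector [0, - (cos (2*t) / 2), sin (2*t) / 2]]"

definition F_loop :: "3 \<Rightarrow> real \<Rightarrow> quat" where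
  "F_loop r t = 3 *\<^sub>R qi + 2 *\<^sub>R imag_quat (row r (Gamma_rows t))"

definition v_loop :: "3 \<Rightarrow> real \<Rightarrow> quat" where
  "v_loop r t = sigma (F_loop r t)"

lemma F_loop_in_domain: "norm (F_loop r t) + F_loop r t \<bullet> qi > 0"
proof -
  have "F_loop r t \<bullet> qi = 3 + 2 * Gamma_rows t $ r $ 1"
    by (simp add: F_loop_def imag_quat_def row_def inner_vec_def sum_4 qi_def qj_def qk_def)
  moreover have "\<bar>Gamma_rows t $ r $ 1\<bar> \<le> 1"
    using exhaust_3[of r] by (auto simp: Gamma_rows_def)
  ultimately show ?thesis
    using norm_ge_zero[of "F_loop r t"] by linarith
qed

definition phi :: "real^3 \<Rightarrow> quat" where
  "phi x = (2 + cos (x$3)) *\<^sub>R qexp_i (x$1) + (2 + sin (x$3)) *\<^sub>R (qexp_i (x$2) \<odot> qj)"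

text \<open>In \<^typ>\<open>real^4\<close> the index 4 is that of the last coordinate \<open>t\<close>; the target
  \<^typ>\<open>quat^3\<close> is 12-dimensional.\<close>

definition h34 :: "(real^3) \<times> (real^4) \<Rightarrow> quat^3" where
  "h34 = (\<lambda>(x, y). let t = y$4 in vector [
     phi x \<odot> v_loop 1 t \<odot> qexp_i (y$1),
     phi x \<odot> v_loop 2 t \<odot> qexp_i (y$2),
     phi x \<odot> v_loop 3 t \<odot> qexp_i (y$3)])"

end

theory Submission
  imports Defs
begin

text \<open>Three facts make the mixed Hessian of \<open>h34\<close> invertible.

  First, \<open>\<phi>\<close> is an immersion of the three-torus into the quaternions whose partial derivatives are all
  orthogonal to an explicit unit vector field \<open>n\<close> (\<open>phi_immersion\<close>, \<open>phi_partial_normal\<close>). Secondly,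
  $v_r i \bar v_r = F_r$, so that the imaginary part of $q_r = v_r' i \bar v_r$ is
  $F_r'/2 = \Gamma_r'$ (\<open>v_deriv_imaginary_part\<close>). Thirdly, $\Gamma_1', \Gamma_2', \Gamma_3'$ are
  orthonormal for every \<open>t\<close> (\<open>orthogonal_to_Gamma_deriv\<close>).

  A linear relation between the mixed derivatives amounts, after the phases $e^{y_r i}$ have been
  cancelled, to tangent vectors $A_1, A_2, A_3, B$ of \<open>\<phi>\<close> at the same point with
  $A_r v_r i + B v_r' = 0$ for every \<open>r\<close>. Hence $B q_r$ is a multiple of $A_r$ and is orthogonal to \<open>n\<close>. As \<open>B\<close>
  itself is orthogonal to \<open>n\<close>, so is $B \Gamma_r'$ for all three \<open>r\<close>; equivalently, the imaginary quaternion
  $\bar B n$ is orthogonal to a basis of the imaginary quaternions. So $B = 0$, then $A_r = 0$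
  (\<open>tangent_equations_trivial\<close>), and since \<open>\<phi>\<close> is an immersion the relation is trivial. Twelve
  independent vectors in a space of dimension twelve form a basis.

  Smoothness follows from closure properties of smooth maps: sums, bounded bilinear products, and
  composition with the sine and with real powers. The last of these handle the norm and the
  square root in \<open>\<sigma>\<close>, whose arguments stay positive along the loops.\<close>

section \<open>Calculus of smooth maps\<close>

lemma times_cont_diff_imp_continuous:
  "times_cont_diff n f \<Longrightarrow> continuous_on UNIV f"
  by (cases n) (auto intro: continuous_at_imp_continuous_on differentiable_imp_continuous_within)

lemma times_cont_diff_SucD: "times_cont_diff (Suc n) f \<Longrightarrow> times_cont_diff n f"
proof (induction n arbitrary: f)
  case 0
  show ?case using times_cont_diff_imp_continuous[OF 0] by simp
next
  case (Suc n)
  show ?case using Suc.prems Suc.IH by (simp only: times_cont_diff.simps) blast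
qed

lemma times_cont_diff_SucI:
  assumes "\<And>p. (f has_derivative f' p) (at p)" and "\<And>v. times_cont_diff n (\<lambda>p. f' p v)"
  shows "times_cont_diff (Suc n) f"
proof -
  have "frechet_derivative f (at p) = f' p" for p
    using assms(1) by (metis frechet_derivative_at)
  then show ?thesis using assms by (auto simp: differentiable_def)
qed

lemma times_cont_diff_has_derivative:
  "times_cont_diff (Suc n) f \<Longrightarrow> (f has_derivative frechet_derivative f (at p)) (at p)"
  by (simp add: frechet_derivative_works)

lemma times_cont_diff_const: "times_cont_diff n (\<lambda>p. c)"
proof (induction n arbitrary: c)
  case (Suc n)
  show ?case by (rule times_cont_diff_SucI[where f' = "\<lambda>p v. 0"]) (auto simp: Suc)
qed simp

lemma times_cont_diff_add:
  assumes "times_cont_diff n f" "times_cont_diff n g"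
  shows "times_cont_diff n (\<lambda>p. f p + g p)"
  using assms
proof (induction n arbitrary: f g)
  case 0
  then show ?case by (auto intro: continuous_intros)
next
  case (Suc n)
  show ?case
  proof (rule times_cont_diff_SucI)
    show "((\<lambda>p. f p + g p) has_derivative
        (\<lambda>v. frechet_derivative f (at p) v + frechet_derivative g (at p) v)) (at p)" for p
      by (intro has_derivative_add Suc.prems[THEN times_cont_diff_has_derivative])
  qed (use Suc in auto)
qed

lemma times_cont_diff_bilinear:
  assumes "bounded_bilinear mul" "times_cont_diff n f" "times_cont_diff n g"
  shows "times_cont_diff n (\<lambda>p. mul (f p) (g p))"
  using assms(2-)
proof (induction n arbitrary: f g)
  case 0
  then show ?case by (auto intro: bounded_bilinear.continuous_on[OF assms(1)])
next
  case (Suc n)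
  show ?case
  proof (rule times_cont_diff_SucI)
    show "((\<lambda>p. mul (f p) (g p)) has_derivative
        (\<lambda>v. mul (f p) (frechet_derivative g (at p) v) +
             mul (frechet_derivative f (at p) v) (g p))) (at p)" for p
      by (intro bounded_bilinear.FDERIV[OF assms(1)] Suc.prems[THEN times_cont_diff_has_derivative])
    show "times_cont_diff n (\<lambda>p. mul (f p) (frechet_derivative g (at p) v) +
             mul (frechet_derivative f (at p) v) (g p))" for v
      using Suc.prems Suc.prems[THEN times_cont_diff_SucD]
      by (intro times_cont_diff_add Suc.IH) auto
  qed
qed

lemma times_cont_diff_linear:
  assumes "bounded_linear L" "times_cont_diff n f"
  shows "times_cont_diff n (\<lambda>p. L (f p))"
  using assms(2)
proof (induction n arbitrary: f)
  case 0
  then show ?case by (auto intro: linear_continuous_on_compose bounded_linear.continuous_on[OF assms(1)])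
next
  case (Suc n)
  show ?case
  proof (rule times_cont_diff_SucI)
    show "((\<lambda>p. L (f p)) has_derivative (\<lambda>v. L (frechet_derivative f (at p) v))) (at p)" for p
      by (intro bounded_linear.has_derivative[OF assms(1)] Suc.prems[THEN times_cont_diff_has_derivative])
  qed (use Suc in auto)
qed

text \<open>A tower of functions, each the derivative of the one before, lets the induction on the order of
differentiability go through for the whole tower at once: differentiating \<open>G k \<circ> f\<close> moves to
\<open>G (Suc k)\<close>. The set \<open>S\<close> accommodates powers, which are differentiable only on the positive half line.\<close>

lemma times_cont_diff_real_compose:
  fixes f :: "'v::real_normed_vector \<Rightarrow> real"
  assumes "\<And>k x. x \<in> S \<Longrightarrow> (G k has_real_derivative G (Suc k) x) (at x)"
    and "range f \<subseteq> S" and "times_cont_diff n f"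
  shows "times_cont_diff n (\<lambda>p. G k (f p))"
  using assms(3,2)
proof (induction n arbitrary: k)
  case 0
  have "continuous_on S (G k)"
    using assms(1) by (intro continuous_at_imp_continuous_on) (auto intro: DERIV_isCont)
  then show ?case using 0 by (auto intro: continuous_on_compose2)
next
  case (Suc n)
  show ?case
  proof (rule times_cont_diff_SucI)
    fix p
    have "(G k has_derivative (\<lambda>h. G (Suc k) (f p) * h)) (at (f p))"
      using assms(1)[of "f p" k] Suc.prems(2) by (auto simp: has_field_derivative_def)
    then show "((\<lambda>p. G k (f p)) has_derivative
        (\<lambda>v. G (Suc k) (f p) * frechet_derivative f (at p) v)) (at p)"
      using has_derivative_compose[OF times_cont_diff_has_derivative[OF Suc.prems(1)]] by auto
    show "times_cont_diff n (\<lambda>p. G (Suc k) (f p) * frechet_derivative f (at p) v)" for v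
      using Suc.prems times_cont_diff_SucD[OF Suc.prems(1)]
      by (intro times_cont_diff_bilinear[OF bounded_bilinear_mult] Suc.IH) auto
  qed
qed

named_theorems smooth_intros

lemma smooth_const [smooth_intros]: "smooth (\<lambda>p. c)"
  by (simp add: smooth_def times_cont_diff_const)

lemma smooth_add [smooth_intros]: "smooth f \<Longrightarrow> smooth g \<Longrightarrow> smooth (\<lambda>p. f p + g p)"
  by (simp add: smooth_def times_cont_diff_add)

lemma smooth_bilinear:
  "bounded_bilinear mul \<Longrightarrow> smooth f \<Longrightarrow> smooth g \<Longrightarrow> smooth (\<lambda>p. mul (f p) (g p))"
  by (simp add: smooth_def times_cont_diff_bilinear)

lemmas smooth_mult [smooth_intros] =
  smooth_bilinear[OF bounded_bilinear_mult[where 'a = real]]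
lemmas smooth_scaleR [smooth_intros] = smooth_bilinear[OF bounded_bilinear_scaleR]
lemmas smooth_inner [smooth_intros] = smooth_bilinear[OF bounded_bilinear_inner]

lemma smooth_linear: "bounded_linear L \<Longrightarrow> smooth f \<Longrightarrow> smooth (\<lambda>p. L (f p))"
  by (simp add: smooth_def times_cont_diff_linear)

lemmas smooth_minus [smooth_intros] = smooth_linear[OF bounded_linear_minus[OF bounded_linear_ident]]
lemmas smooth_vec_nth [smooth_intros] = smooth_linear[OF bounded_linear_vec_nth]
lemmas smooth_fst [smooth_intros] = smooth_linear[OF bounded_linear_fst]
lemmas smooth_snd [smooth_intros] = smooth_linear[OF bounded_linear_snd]

lemma smooth_diff [smooth_intros]:
  assumes "smooth f" "smooth g" shows "smooth (\<lambda>p. f p - g p)"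
  using smooth_add[OF assms(1) smooth_minus[OF assms(2)]] by simp

lemma smooth_divide_const [smooth_intros]:
  fixes f :: "'v::real_normed_vector \<Rightarrow> real"
  shows "smooth f \<Longrightarrow> smooth (\<lambda>p. f p / c)"
  by (rule smooth_linear[OF bounded_linear_divide])

lemma smooth_id [smooth_intros]: "smooth (\<lambda>p. p)"
  unfolding smooth_def
proof
  fix n show "times_cont_diff n (\<lambda>p::'a. p)"
  proof (cases n)
    case (Suc m)
    show ?thesis unfolding Suc
      by (rule times_cont_diff_SucI[where f' = "\<lambda>p v. v"]) (auto simp: times_cont_diff_const)
  qed auto
qed

lemma smooth_sum:
  assumes "\<And>i. i \<in> A \<Longrightarrow> smooth (f i)" shows "smooth (\<lambda>p. \<Sum>i\<in>A. f i p)"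
  using assms by (induction A rule: infinite_finite_induct) (auto intro: smooth_intros)

lemma bounded_linear_axis: "bounded_linear (axis i :: 'w::euclidean_space \<Rightarrow> 'w^'n)"
  by (intro linear_conv_bounded_linear[THEN iffD1] linearI) (auto simp: axis_def vec_eq_iff)

lemma vec_eq_sum_axis: "(u :: 'w::euclidean_space^'n) = (\<Sum>i\<in>UNIV. axis i (u $ i))"
proof -
  have "(\<Sum>i\<in>UNIV. axis i (u $ i)) $ k = (\<Sum>i\<in>UNIV. if i = k then u $ k else 0)" for k
    unfolding sum_component by (intro sum.cong) (auto simp: axis_def)
  then show ?thesis unfolding vec_eq_iff by simp
qed

lemma smooth_componentwise:
  fixes f :: "'v::real_normed_vector \<Rightarrow> 'w::euclidean_space^'n"
  assumes "\<And>i. smooth (\<lambda>p. f p $ i)"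
  shows "smooth f"
proof -
  have "smooth (\<lambda>p. \<Sum>i\<in>UNIV. axis i (f p $ i))"
    by (intro smooth_sum smooth_linear[OF bounded_linear_axis] assms)
  then show ?thesis by (simp flip: vec_eq_sum_axis)
qed

lemma has_vector_derivative_componentwise:
  fixes f :: "real \<Rightarrow> 'w::euclidean_space^'n"
  assumes "\<And>i. ((\<lambda>s. f s $ i) has_vector_derivative f' $ i) (at t)"
  shows "(f has_vector_derivative f') (at t)"
proof -
  have "((\<lambda>s. \<Sum>i\<in>UNIV. axis i (f s $ i)) has_vector_derivative (\<Sum>i\<in>UNIV. axis i (f' $ i))) (at t)"
    by (intro has_vector_derivative_sum bounded_linear.has_vector_derivative[OF bounded_linear_axis] assms)
  then show ?thesis by (simp flip: vec_eq_sum_axis)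
qed

text \<open>Quarter-period shifts turn the four-periodic sequence of derivatives of the sine into a tower.\<close>

lemma sin_quarter_shift_has_derivative:
  "((\<lambda>x. sin (x + real k * (pi/2))) has_real_derivative sin (x + real (Suc k) * (pi/2))) (at x)"
proof -
  have shift: "x + real (Suc k) * (pi/2) = (x + real k * (pi/2)) + pi/2"
    by (simp add: field_simps)
  have "sin (x + real (Suc k) * (pi/2)) = cos (x + real k * (pi/2))"
    unfolding shift sin_add cos_pi_half sin_pi_half by simp
  moreover have "((\<lambda>x. sin (x + a)) has_real_derivative cos (x + a)) (at x)" for a
    by (auto intro!: derivative_eq_intros)
  ultimately show ?thesis by (simp only:)
qed

lemma smooth_sin [smooth_intros]:
  assumes "smooth f" shows "smooth (\<lambda>p. sin (f p :: real))"
  using assms times_cont_diff_real_compose[where G = "\<lambda>k x. sin (x + real k * (pi/2))" and k = 0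
      and S = UNIV and f = f, OF sin_quarter_shift_has_derivative]
  by (simp add: smooth_def)

lemma smooth_cos [smooth_intros]:
  assumes "smooth f" shows "smooth (\<lambda>p. cos (f p :: real))"
  using smooth_sin[OF smooth_diff[OF smooth_const assms], of "pi/2"] by (simp add: cos_diff sin_diff)

text \<open>Real powers form a tower up to falling factorials, so one lemma yields square roots and inverses.\<close>

lemma smooth_powr:
  fixes f :: "'v::real_normed_vector \<Rightarrow> real"
  assumes "smooth f" and "\<And>p. f p > 0"
  shows "smooth (\<lambda>p. f p powr a)"
proof -
  define G where "G = (\<lambda>(k::nat) x. (\<Prod>i<k. a - real i) * x powr (a - real k))"
  have "(G k has_real_derivative G (Suc k) x) (at x)" if "x \<in> {0<..}" for k x
  proof -
    have "((\<lambda>x. x powr (a - real k)) has_real_derivative (a - real k) * x powr (a - real k - 1)) (at x)"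
      using that by (intro has_real_derivative_powr) auto
    from DERIV_cmult[OF this, of "\<Prod>i<k. a - real i"] show ?thesis
      by (simp add: G_def diff_diff_eq add.commute mult.assoc)
  qed
  from times_cont_diff_real_compose[where G = G and S = "{0<..}" and f = f and k = 0, OF this] show ?thesis
    using assms by (auto simp: smooth_def G_def image_subset_iff)
qed

lemma smooth_sqrt: "smooth f \<Longrightarrow> (\<And>p. f p > 0) \<Longrightarrow> smooth (\<lambda>p. sqrt (f p))"
  using smooth_powr[of f "1/2"] by (simp add: powr_half_sqrt less_imp_le)

lemma smooth_inverse: "smooth f \<Longrightarrow> (\<And>p. (f p :: real) > 0) \<Longrightarrow> smooth (\<lambda>p. inverse (f p))"
  using smooth_powr[of f "-1"] by (simp add: powr_minus less_imp_le)

lemma smooth_norm: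
  fixes f :: "'v::real_normed_vector \<Rightarrow> 'w::real_inner"
  assumes "smooth f" "\<And>p. f p \<noteq> 0" shows "smooth (\<lambda>p. norm (f p))"
  unfolding norm_eq_sqrt_inner using assms by (intro smooth_sqrt smooth_inner) auto

lemma smooth_has_vector_derivative:
  assumes "smooth f"
  shows "(f has_vector_derivative vector_derivative f (at t)) (at t)"
proof -
  have "times_cont_diff (Suc 0) f" using assms unfolding smooth_def by blast
  then show ?thesis by (simp add: vector_derivative_works[symmetric])
qed

section \<open>Bases from a count of dimensions\<close>

text \<open>The combinations of the family are the values of a linear map on \<open>real^'i\<close>. Linear independence makes
that map injective, so it carries the standard basis to an independent set, which spans because it has
as many elements as the dimension of the space.\<close>

lemma basis_familyI:
  fixes b :: "'i::finite \<Rightarrow> 'c::euclidean_space"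
  assumes "CARD('i) = DIM('c)"
    and indep: "\<And>c k. (\<Sum>k\<in>UNIV. c k *\<^sub>R b k) = 0 \<Longrightarrow> c k = 0"
  shows "basis_family b"
proof -
  define L where "L = (\<lambda>c::real^'i. \<Sum>k\<in>UNIV. (c $ k) *\<^sub>R b k)"
  have linear: "linear L"
    unfolding L_def by (intro linearI) (auto simp: scaleR_left_distrib sum.distrib scaleR_sum_right)
  have "inj L"
    unfolding linear_injective_0[OF linear] using indep by (auto simp: L_def vec_eq_iff)
  have b: "b = L \<circ> (\<lambda>k. axis k 1)"
    by (auto simp: fun_eq_iff L_def axis_def if_distrib[of "\<lambda>c. c *\<^sub>R _"] cong: if_cong)
  have "inj b" unfolding b
    using \<open>inj L\<close> by (intro inj_compose) (auto simp: inj_def axis_eq_axis)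
  have "range b = L ` Basis" unfolding b by (auto simp: Basis_vec_def image_def)
  moreover have "independent (L ` Basis)"
    using linear_independent_injective_image[OF linear independent_Basis] \<open>inj L\<close>
    by simp
  ultimately have "independent (range b)" by simp
  moreover have "card (range b) = DIM('c)"
    using assms(1) \<open>inj b\<close> by (simp add: card_image)
  ultimately have "UNIV \<subseteq> span (range b)"
    by (intro card_ge_dim_independent) auto
  with \<open>inj b\<close> \<open>independent (range b)\<close> show ?thesis by (auto simp: basis_family_def)
qed

section \<open>Quaternion algebra\<close>

definition qconj :: "quat \<Rightarrow> quat" where
  "qconj a = quat (a$1) (- a$2) (- a$3) (- a$4)"

lemma qmult_nth:
  "(a \<odot> b) $ 1 = a$1 * b$1 - a$2 * b$2 - a$3 * b$3 - a$4 * b$4"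
  "(a \<odot> b) $ 2 = a$1 * b$2 + a$2 * b$1 + a$3 * b$4 - a$4 * b$3"
  "(a \<odot> b) $ 3 = a$1 * b$3 - a$2 * b$4 + a$3 * b$1 + a$4 * b$2"
  "(a \<odot> b) $ 4 = a$1 * b$4 + a$2 * b$3 - a$3 * b$2 + a$4 * b$1"
  by (simp_all add: qmult_def)

lemma qconj_nth:
  "qconj a $ 1 = a$1" "qconj a $ 2 = - a$2" "qconj a $ 3 = - a$3" "qconj a $ 4 = - a$4"
  by (simp_all add: qconj_def)

lemma quat_of_real_nth:
  "quat_of_real r $ 1 = r" "quat_of_real r $ 2 = 0" "quat_of_real r $ 3 = 0" "quat_of_real r $ 4 = 0"
  by (simp_all add: quat_of_real_def)

lemma qunit_nth:
  "qi $ 1 = 0" "qi $ 2 = 1" "qi $ 3 = 0" "qi $ 4 = 0"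
  "qj $ 1 = 0" "qj $ 2 = 0" "qj $ 3 = 1" "qj $ 4 = 0"
  "qk $ 1 = 0" "qk $ 2 = 0" "qk $ 3 = 0" "qk $ 4 = 1"
  by (simp_all add: qi_def qj_def qk_def)

lemma quat_inner: "(a::quat) \<bullet> b = a$1 * b$1 + a$2 * b$2 + a$3 * b$3 + a$4 * b$4"
  by (simp add: inner_vec_def sum_4)

lemmas quat_coords = quat_eq_iff qmult_nth qconj_nth quat_of_real_nth qunit_nth quat_inner

lemma bounded_bilinear_qmult: "bounded_bilinear (\<odot>)"
  unfolding bilinear_conv_bounded_bilinear[symmetric] bilinear_def
  by (auto intro!: linearI simp: quat_coords algebra_simps)

interpretation qmult: bounded_bilinear "(\<odot>)"
  by (rule bounded_bilinear_qmult)

lemmas smooth_qmult [smooth_intros] = smooth_bilinear[OF bounded_bilinear_qmult]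

lemma bounded_linear_qconj: "bounded_linear qconj"
  unfolding linear_conv_bounded_linear[symmetric]
  by (auto intro!: linearI simp: quat_coords)

lemma bounded_linear_quat_of_real: "bounded_linear quat_of_real"
  unfolding linear_conv_bounded_linear[symmetric]
  by (auto intro!: linearI simp: quat_coords)

lemmas smooth_quat_of_real [smooth_intros] = smooth_linear[OF bounded_linear_quat_of_real]

lemma qmult_assoc: "a \<odot> b \<odot> c = a \<odot> (b \<odot> c)"
  by (simp add: quat_coords algebra_simps)

lemma qmult_quat_of_real: "a \<odot> quat_of_real r = r *\<^sub>R a"
  by (simp add: quat_coords)

lemma qexp_i_inverse: "qexp_i y \<odot> qexp_i (- y) = quat_of_real 1"
  by (simp add: qexp_i_def quat_coords flip: power2_eq_square)

lemma qexp_i_has_derivative [derivative_intros]: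
  assumes "(f has_field_derivative f') (at s)"
  shows "((\<lambda>s. qexp_i (f s)) has_vector_derivative f' *\<^sub>R (qi \<odot> qexp_i (f s))) (at s)"
proof -
  have "qexp_i (f s) = cos (f s) *\<^sub>R quat_of_real 1 + sin (f s) *\<^sub>R qi" for s
    by (simp add: qexp_i_def quat_coords)
  moreover have "((\<lambda>s. cos (f s) *\<^sub>R quat_of_real 1 + sin (f s) *\<^sub>R qi) has_vector_derivative
      f' *\<^sub>R (qi \<odot> qexp_i (f s))) (at s)"
    using assms
    by (auto intro!: derivative_eq_intros simp: qexp_i_def quat_coords)
  ultimately show ?thesis by simp
qed

lemma smooth_qexp_i [smooth_intros]: "smooth f \<Longrightarrow> smooth (\<lambda>p. qexp_i (f p))"
  unfolding qexp_i_def by (intro smooth_intros)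

section \<open>The lifts of the loops\<close>

text \<open>The map \<open>\<sigma>\<close> is a section of the Hopf-type map $v \mapsto v i \bar v$. Write $w = \rho - \xi i$; then
$w i \bar w = (\rho i + \xi)(\rho - i\xi) = \rho^2 i + 2\rho\xi - \xi i \xi$, and
$\xi i \xi = \rho^2 i - 2\xi_1\xi$, so the result is $2(\rho + \xi_1)\xi$: the normalising factor
of \<open>\<sigma>\<close> is exactly what cancels the scalar.\<close>

lemma sigma_conjugates_qi:
  assumes "\<xi>$1 = 0" "norm \<xi> + \<xi> \<bullet> qi > 0"
  shows "sigma \<xi> \<odot> qi \<odot> qconj (sigma \<xi>) = \<xi>"
proof -
  define d where "d = norm \<xi> + \<xi>$2"
  define w where "w = quat_of_real (norm \<xi>) - \<xi> \<odot> qi"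
  have "d > 0" using assms(2) by (simp add: d_def quat_coords)
  have sigma: "sigma \<xi> = inverse (sqrt (2 * d)) *\<^sub>R w"
    by (simp add: sigma_def Let_def w_def d_def quat_coords)
  have norm: "norm \<xi> * norm \<xi> = \<xi>$2 * \<xi>$2 + \<xi>$3 * \<xi>$3 + \<xi>$4 * \<xi>$4"
    using power2_norm_eq_inner[of \<xi>] assms(1) by (simp add: quat_inner power2_eq_square)
  have "w \<odot> qi \<odot> qconj w = (2 * d) *\<^sub>R \<xi>"
    using assms(1) norm by (simp add: w_def d_def quat_coords algebra_simps)
  moreover have "sigma \<xi> \<odot> qi \<odot> qconj (sigma \<xi>) = inverse (2 * d) *\<^sub>R (w \<odot> qi \<odot> qconj w)"
  proof -
    have "inverse (sqrt (2 * d)) * inverse (sqrt (2 * d)) = inverse (2 * d)"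
      using \<open>d > 0\<close> by (simp flip: real_sqrt_mult inverse_mult_distrib)
    then show ?thesis
      unfolding sigma linear_scale[OF bounded_linear.linear[OF bounded_linear_qconj]]
        qmult.scaleR_left qmult.scaleR_right
      by simp
  qed
  ultimately show ?thesis using \<open>d > 0\<close> by simp
qed

text \<open>Product-to-sum formulas give these entries. In this form the rows are visibly orthonormal: the matrix
is a rotation by \<open>t\<close> composed with one by \<open>2 * t\<close>.\<close>

definition Gamma_deriv :: "real \<Rightarrow> real^3^3" where
  "Gamma_deriv t = vector [
     vector [cos t, - (cos (2*t) * sin t), sin (2*t) * sin t],
     vector [sin t, cos (2*t) * cos t, - (sin (2*t) * cos t)],
     vector [0, sin (2*t), cos (2*t)]]"

lemma Gamma_rows_has_derivative:
  "((\<lambda>t. Gamma_rows t $ r $ c) has_real_derivative Gamma_deriv t $ r $ c) (at t)"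
proof -
  have products:
    "cos (2*t) * sin t = (sin (3*t) - sin t) / 2" "sin (2*t) * sin t = (cos t - cos (3*t)) / 2"
    "cos (2*t) * cos t = (cos t + cos (3*t)) / 2" "sin (2*t) * cos t = (sin (3*t) + sin t) / 2"
    using cos_times_sin[of "2*t" t] sin_times_sin[of "2*t" t] cos_times_cos[of "2*t" t]
      sin_times_cos[of "2*t" t] by simp_all
  show ?thesis
    using exhaust_3[of r] exhaust_3[of c]
    by (elim disjE; simp add: Gamma_rows_def Gamma_deriv_def products;
        auto intro!: derivative_eq_intros simp: field_simps)
qed

lemma imag_quat_nth:
  "imag_quat u $ 1 = 0" "imag_quat u $ 2 = u$1" "imag_quat u $ 3 = u$2" "imag_quat u $ 4 = u$3"
  by (simp_all add: imag_quat_def qunit_nth)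

lemma F_loop_nth:
  "F_loop r t $ 1 = 0" "F_loop r t $ 2 = 3 + 2 * Gamma_rows t $ r $ 1"
  "F_loop r t $ 3 = 2 * Gamma_rows t $ r $ 2" "F_loop r t $ 4 = 2 * Gamma_rows t $ r $ 3"
  by (simp_all add: F_loop_def imag_quat_nth qunit_nth row_def)

lemma F_loop_has_derivative:
  "(F_loop r has_vector_derivative 2 *\<^sub>R imag_quat (row r (Gamma_deriv t))) (at t)"
proof -
  have F: "F_loop r = (\<lambda>t. 3 *\<^sub>R qi + 2 *\<^sub>R ((Gamma_rows t $ r $ 1) *\<^sub>R qi +
      (Gamma_rows t $ r $ 2) *\<^sub>R qj + (Gamma_rows t $ r $ 3) *\<^sub>R qk))"
    by (auto simp: F_loop_def imag_quat_def row_def)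
  show ?thesis
    unfolding F imag_quat_def
    by (auto intro!: derivative_eq_intros Gamma_rows_has_derivative simp: row_def)
qed

text \<open>The three derivatives $\Gamma_r'(t)$ form a basis of the imaginary quaternions at every \<open>t\<close>. This
nondegeneracy is what makes the mixed Hessian invertible: it excludes a common imaginary direction
orthogonal to all three velocities.\<close>

lemma orthogonal_to_Gamma_deriv:
  assumes "u$1 = 0" and orth: "\<And>r. imag_quat (row r (Gamma_deriv t)) \<bullet> u = 0"
  shows "u = 0"
proof -
  define c s C S where defs: "c = cos t" "s = sin t" "C = cos (2*t)" "S = sin (2*t)"
  have pyth: "s * s + c * c = 1" "S * S + C * C = 1"
    unfolding defs by (simp_all flip: power2_eq_square)
  have e: "c * u$2 - C * s * u$3 + S * s * u$4 = 0" "s * u$2 + C * c * u$3 - S * c * u$4 = 0"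
     "S * u$3 + C * u$4 = 0"
    using orth[of 1] orth[of 2] orth[of 3]
    by (simp_all add: quat_inner imag_quat_nth row_def Gamma_deriv_def defs)
  \<comment> \<open>The first two equations rotated back by the angle \<open>t\<close>, then by \<open>2 * t\<close>.\<close>
  have u2: "u$2 = 0" using e(1,2) pyth(1) by algebra
  have "C * u$3 - S * u$4 = 0" using e(1,2) pyth(1) by algebra
  with e(3) pyth(2) have "u$3 = 0" "u$4 = 0" by algebra+
  with u2 assms(1) show ?thesis by (simp add: quat_eq_iff)
qed

lemma F_loop_nonzero: "F_loop r t \<noteq> 0"
  using F_loop_in_domain[of r t] by force

lemma smooth_F_loop:
  assumes "smooth f" shows "smooth (\<lambda>p. F_loop r (f p))"
proof (rule smooth_componentwise)
  have Gamma: "smooth (\<lambda>p. Gamma_rows (f p) $ r $ c)" for c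
    using exhaust_3[of r] exhaust_3[of c]
    by (elim disjE; simp add: Gamma_rows_def; intro smooth_intros assms)
  show "smooth (\<lambda>p. F_loop r (f p) $ m)" for m
    using exhaust_4[of m]
    by (elim disjE; simp add: F_loop_nth; intro smooth_const smooth_add smooth_mult Gamma)
qed

lemma smooth_v_loop: "smooth f \<Longrightarrow> smooth (\<lambda>p. v_loop r (f p))"
  unfolding v_loop_def sigma_def Let_def
  by (intro smooth_intros smooth_inverse smooth_sqrt smooth_norm smooth_F_loop F_loop_nonzero
      mult_pos_pos F_loop_in_domain real_sqrt_gt_zero zero_less_numeral)

lemma v_loop_conjugates_qi: "v_loop r t \<odot> qi \<odot> qconj (v_loop r t) = F_loop r t"
  unfolding v_loop_def by (intro sigma_conjugates_qi F_loop_in_domain F_loop_nth)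

lemma v_loop_nonzero: "v_loop r t \<noteq> 0"
  using v_loop_conjugates_qi[of r t] F_loop_nonzero[of r t] by (auto simp: qmult.zero_left)

definition v_deriv :: "3 \<Rightarrow> real \<Rightarrow> quat" where
  "v_deriv r t = vector_derivative (v_loop r) (at t)"

lemma v_loop_has_derivative: "(v_loop r has_vector_derivative v_deriv r t) (at t)"
  unfolding v_deriv_def by (rule smooth_has_vector_derivative[OF smooth_v_loop[OF smooth_id]])

text \<open>Differentiating $v i \bar v = F$ gives $q + p = F' = 2\Gamma'$ with $q = v' i \bar v$ and
$p = v i \bar v'$. Since $p = -\bar q$, this sum is twice the imaginary part of \<open>q\<close>. The real part,
which depends on how \<open>\<sigma>\<close> was chosen among the lifts of \<open>F\<close>, is left unspecified.\<close>

lemma v_deriv_imaginary_part: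
  obtains \<gamma> where "v_deriv r t \<odot> qi \<odot> qconj (v_loop r t)
    = quat_of_real \<gamma> + imag_quat (row r (Gamma_deriv t))"
proof -
  let ?v = "v_loop r t" and ?v' = "v_deriv r t"
  have "((\<lambda>t. v_loop r t \<odot> qi \<odot> qconj (v_loop r t)) has_vector_derivative
     (?v \<odot> qi \<odot> qconj ?v' + ?v' \<odot> qi \<odot> qconj ?v)) (at t)"
    by (intro qmult.has_vector_derivative bounded_linear.has_vector_derivative[OF bounded_linear_qconj]
      bounded_linear.has_vector_derivative[OF qmult.bounded_linear_left] v_loop_has_derivative)
  then have "?v \<odot> qi \<odot> qconj ?v' + ?v' \<odot> qi \<odot> qconj ?v = 2 *\<^sub>R imag_quat (row r (Gamma_deriv t))"
    unfolding v_loop_conjugates_qi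
    using F_loop_has_derivative vector_derivative_unique_at by blast
  then have "?v' \<odot> qi \<odot> qconj ?v
      = quat_of_real ((?v' \<odot> qi \<odot> qconj ?v) $ 1) + imag_quat (row r (Gamma_deriv t))"
    by (simp add: quat_coords imag_quat_nth algebra_simps)
  then show ?thesis by (rule that)
qed

section \<open>The immersed torus\<close>

definition phi_partial :: "3 \<Rightarrow> real^3 \<Rightarrow> quat" where
  "phi_partial i x =
    (if i = 1 then (2 + cos (x$3)) *\<^sub>R (qi \<odot> qexp_i (x$1))
     else if i = 2 then (2 + sin (x$3)) *\<^sub>R (qi \<odot> qexp_i (x$2) \<odot> qj)
     else cos (x$3) *\<^sub>R (qexp_i (x$2) \<odot> qj) - sin (x$3) *\<^sub>R qexp_i (x$1))"

definition phi_normal :: "real^3 \<Rightarrow> quat" where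
  "phi_normal x = cos (x$3) *\<^sub>R qexp_i (x$1) + sin (x$3) *\<^sub>R (qexp_i (x$2) \<odot> qj)"

lemma phi_has_partial:
  "((\<lambda>s. phi (x + s *\<^sub>R axis i 1)) has_vector_derivative phi_partial i x) (at 0)"
  using exhaust_3[of i]
  by (auto simp: phi_def phi_partial_def axis_def qmult.scaleR_left
      intro!: derivative_eq_intros bounded_linear.has_vector_derivative[OF qmult.bounded_linear_left])

text \<open>The complex line of quaternions $a + bi$ and its orthogonal complement, the quaternions $(a + bi)j$,
contain the circles \<open>e\<close> and \<open>f\<close>; each circle and its unit tangent form an orthonormal basis of its plane.\<close>

lemma frame_orthonormal:
  fixes a b
  defines "e \<equiv> qexp_i a" and "f \<equiv> qexp_i b \<odot> qj"
    and "e' \<equiv> qi \<odot> qexp_i a" and "f' \<equiv> qi \<odot> qexp_i b \<odot> qj"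
  shows "e \<bullet> e = 1" "f \<bullet> f = 1" "e' \<bullet> e' = 1" "f' \<bullet> f' = 1"
    "e' \<bullet> e = 0" "f' \<bullet> f = 0" "e \<bullet> f = 0" "e' \<bullet> f = 0" "f' \<bullet> e = 0" "e' \<bullet> f' = 0"
  by (simp_all add: assms qexp_i_def quat_coords flip: power2_eq_square)

lemma phi_partial_orthogonal:
  assumes "i \<noteq> j" shows "phi_partial i x \<bullet> phi_partial j x = 0"
  using exhaust_3[of i] exhaust_3[of j] assms
  by (elim disjE; simp add: phi_partial_def inner_diff_left inner_diff_right frame_orthonormal
      frame_orthonormal[THEN trans[OF inner_commute]])

lemma phi_partial_normal: "phi_partial i x \<bullet> phi_normal x = 0"
  by (simp add: phi_partial_def phi_normal_def inner_diff_left inner_add_right frame_orthonormal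
      frame_orthonormal[THEN trans[OF inner_commute]])

lemma phi_normal_nonzero: "phi_normal x \<noteq> 0"
proof -
  have "phi_normal x \<bullet> phi_normal x = 1"
    by (simp add: phi_normal_def inner_add_left inner_add_right frame_orthonormal
        frame_orthonormal[THEN trans[OF inner_commute]] flip: power2_eq_square)
  then show ?thesis by auto
qed

lemma phi_partial_nonzero: "phi_partial i x \<noteq> 0"
proof -
  have "2 + cos (x$3) \<noteq> 0" "2 + sin (x$3) \<noteq> 0"
    using cos_ge_minus_one[of "x$3"] sin_ge_minus_one[of "x$3"] by linarith+
  moreover have "phi_partial i x \<bullet> phi_partial i x =
      (if i = 1 then (2 + cos (x$3))^2 else if i = 2 then (2 + sin (x$3))^2 else 1)"
    by (simp add: phi_partial_def inner_diff_left inner_diff_right frame_orthonormal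
        frame_orthonormal[THEN trans[OF inner_commute]] flip: power2_eq_square)
  ultimately have "phi_partial i x \<bullet> phi_partial i x \<noteq> 0" by (simp split: if_splits)
  then show ?thesis by auto
qed

text \<open>The partial derivatives of \<open>\<phi>\<close> are nonzero and pairwise orthogonal: the first two are tangent to the
circles \<open>e\<close> and \<open>f\<close>, with the nowhere vanishing factors $2 + \cos x_3$ and $2 + \sin x_3$, and
the third is a unit vector in the plane of the position vectors \<open>e\<close> and \<open>f\<close>.\<close>

lemma phi_immersion:
  assumes "(\<Sum>i\<in>UNIV. c i *\<^sub>R phi_partial i x) = 0"
  shows "c j = 0"
proof -
  have "0 = (\<Sum>i\<in>UNIV. c i *\<^sub>R phi_partial i x) \<bullet> phi_partial j x"
    using assms by simp
  also have "\<dots> = (\<Sum>i\<in>UNIV. if i = j then c j * (phi_partial j x \<bullet> phi_partial j x) else 0)"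
    unfolding inner_sum_left by (intro sum.cong) (auto simp: phi_partial_orthogonal)
  finally show ?thesis using phi_partial_nonzero[of j x] by simp
qed

lemma smooth_phi: "smooth f \<Longrightarrow> smooth (\<lambda>p. phi (f p))"
  unfolding phi_def by (intro smooth_intros)

section \<open>The mixed Hessian\<close>

text \<open>The index of the angle by which the component \<open>r\<close> of \<open>h34\<close> is rotated, as an index of the second torus.\<close>

definition phase :: "3 \<Rightarrow> 4" where
  "phase r = (if r = 1 then 1 else if r = 2 then 2 else 3)"

lemma phase_simps: "phase 1 = 1" "phase 2 = 2" "phase 3 = 3" "phase r \<noteq> 4"
  by (simp_all add: phase_def)

lemma h34_eq:
  "h34 (x, y) = (\<chi> r. phi x \<odot> (v_loop r (y$4) \<odot> qexp_i (y $ phase r)))"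
  by (simp add: h34_def Let_def vec_eq_iff forall_3 phase_simps qmult_assoc)

text \<open>The first summand is the derivative along \<open>t\<close>, which acts on all components; the second is the
derivative along \<open>y\<^sub>1\<close>, \<open>y\<^sub>2\<close> or \<open>y\<^sub>3\<close>, which acts on one component only. It uses that \<open>qi\<close> commutes
with \<open>qexp_i\<close>, and \<open>axis j 1 $ m\<close> serves as a Kronecker delta.\<close>

definition loop_partial :: "4 \<Rightarrow> 3 \<Rightarrow> real^4 \<Rightarrow> quat" where
  "loop_partial j r y =
    ((axis j 1 $ 4) *\<^sub>R v_deriv r (y$4) + (axis j 1 $ phase r) *\<^sub>R (v_loop r (y$4) \<odot> qi))
      \<odot> qexp_i (y $ phase r)"

lemma loop_has_partial:
  "((\<lambda>s. v_loop r ((y + s *\<^sub>R axis j 1) $ 4) \<odot> qexp_i ((y + s *\<^sub>R axis j 1) $ phase r))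
     has_vector_derivative loop_partial j r y) (at 0)"
proof -
  have coord: "((\<lambda>s. (y + s *\<^sub>R axis j 1) $ m) has_real_derivative axis j 1 $ m) (at 0)" for m
    by (auto intro!: derivative_eq_intros)
  have "((\<lambda>s. v_loop r ((y + s *\<^sub>R axis j 1) $ 4)) has_vector_derivative
      (axis j 1 $ 4) *\<^sub>R v_deriv r (y$4)) (at 0)"
    using vector_diff_chain_at[of "\<lambda>s. (y + s *\<^sub>R axis j 1) $ 4" "axis j 1 $ 4" 0 "v_loop r"]
      coord[of 4] v_loop_has_derivative[of r "y$4"]
    by (auto simp: has_real_derivative_iff_has_vector_derivative o_def)
  from qmult.has_vector_derivative[OF this qexp_i_has_derivative[OF coord[of "phase r"]]]
  show ?thesis
    by (simp add: loop_partial_def qmult.add_left qmult.scaleR_left qmult.scaleR_right qmult_assoc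
        add.commute)
qed

lemma partial_y_h34: "partial_y j h34 (x, y) = (\<chi> r. phi x \<odot> loop_partial j r y)"
proof -
  have "((\<lambda>s. h34 (x, y + s *\<^sub>R axis j 1)) has_vector_derivative
      (\<chi> r. phi x \<odot> loop_partial j r y)) (at 0)"
    unfolding h34_eq
    by (rule has_vector_derivative_componentwise, unfold vec_lambda_beta)
       (rule bounded_linear.has_vector_derivative[OF qmult.bounded_linear_right loop_has_partial])
  then show ?thesis by (simp add: partial_y_def vector_derivative_at)
qed

lemma mixed_partial_h34:
  "partial_x i (partial_y j h34) (x, y) = (\<chi> r. phi_partial i x \<odot> loop_partial j r y)"
proof -
  have "((\<lambda>s. partial_y j h34 (x + s *\<^sub>R axis i 1, y)) has_vector_derivative
      (\<chi> r. phi_partial i x \<odot> loop_partial j r y)) (at 0)"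
    unfolding partial_y_h34
    by (rule has_vector_derivative_componentwise, unfold vec_lambda_beta)
       (rule bounded_linear.has_vector_derivative[OF qmult.bounded_linear_left phi_has_partial])
  then show ?thesis by (simp add: partial_x_def vector_derivative_at)
qed

text \<open>The core of the argument. Multiplying the equation for \<open>r\<close> on the right by $i \bar v_r$ turns it into
$|v_r|^2 A_r = B q_r$ with $q_r = v_r' i \bar v_r$. Both \<open>B\<close> and $B q_r$ are therefore orthogonal
to \<open>n\<close>. The real part of $q_r$ contributes a multiple of \<open>B\<close> to $B q_r$, so it drops out, and what remains is
$\langle B \Gamma_r', n\rangle = \langle \Gamma_r', \bar B n\rangle = 0$ for the three values of \<open>r\<close>.
The quaternion $\bar B n$ is imaginary because its real part is $\langle B, n\rangle$, so it vanishes,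
and \<open>B\<close> with it.\<close>

lemma tangent_equations_trivial:
  assumes n: "n \<noteq> 0" and tangent: "B \<bullet> n = 0" "\<And>r. A r \<bullet> n = 0"
    and eqs: "\<And>r. B \<odot> v_deriv r t + A r \<odot> (v_loop r t \<odot> qi) = 0"
  shows "B = 0" "A r = 0"
proof -
  have A: "(v_loop r t \<bullet> v_loop r t) *\<^sub>R A r = B \<odot> (v_deriv r t \<odot> qi \<odot> qconj (v_loop r t))" for r
  proof -
    \<comment> \<open>Right multiplication by $i \bar v_r$: the square of \<open>qi\<close> and $v_r \bar v_r = |v_r|^2$ produce the scalar.\<close>
    have "0 = (B \<odot> v_deriv r t + A r \<odot> (v_loop r t \<odot> qi)) \<odot> (qi \<odot> qconj (v_loop r t))"
      by (simp add: eqs qmult.zero_left)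
    also have "\<dots> = B \<odot> (v_deriv r t \<odot> qi \<odot> qconj (v_loop r t)) -
        (v_loop r t \<bullet> v_loop r t) *\<^sub>R A r"
      by (simp add: quat_coords algebra_simps)
    finally show ?thesis by simp
  qed
  have adjoint: "(B \<odot> q) \<bullet> n = q \<bullet> (qconj B \<odot> n)" for q
    by (simp add: quat_coords algebra_simps)
  have "qconj B \<odot> n = 0"
  proof (rule orthogonal_to_Gamma_deriv)
    show real: "(qconj B \<odot> n) $ 1 = 0"
      using tangent(1) by (simp add: quat_coords)
    fix r
    obtain \<gamma> where \<gamma>: "v_deriv r t \<odot> qi \<odot> qconj (v_loop r t)
        = quat_of_real \<gamma> + imag_quat (row r (Gamma_deriv t))"
      by (rule v_deriv_imaginary_part)
    have "(quat_of_real \<gamma> + imag_quat (row r (Gamma_deriv t))) \<bullet> (qconj B \<odot> n) = 0"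
      using tangent(2)[of r] by (simp flip: \<gamma> adjoint A)
    moreover have "quat_of_real \<gamma> \<bullet> (qconj B \<odot> n) = 0"
      using real by (simp add: quat_inner quat_of_real_nth)
    ultimately show "imag_quat (row r (Gamma_deriv t)) \<bullet> (qconj B \<odot> n) = 0"
      by (simp add: inner_add_left)
  qed
  then have "B \<odot> (qconj B \<odot> n) = 0" by (simp add: qmult.zero_right)
  moreover have "B \<odot> (qconj B \<odot> n) = (B \<bullet> B) *\<^sub>R n"
    by (simp add: quat_coords algebra_simps)
  ultimately show "B = 0" using n by simp
  then show "A r = 0" using A[of r] v_loop_nonzero[of r t] by (simp add: qmult.zero_left)
qed

lemma sum_loop_partial:
  "(\<Sum>j\<in>UNIV. a j *\<^sub>R loop_partial j r y) =
    (a 4 *\<^sub>R v_deriv r (y$4) + a (phase r) *\<^sub>R (v_loop r (y$4) \<odot> qi)) \<odot> qexp_i (y $ phase r)"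
proof -
  have "(\<Sum>j\<in>UNIV. a j *\<^sub>R loop_partial j r y) =
    ((\<Sum>j\<in>UNIV. a j * axis j 1 $ 4) *\<^sub>R v_deriv r (y$4) +
     (\<Sum>j\<in>UNIV. a j * axis j 1 $ phase r) *\<^sub>R (v_loop r (y$4) \<odot> qi)) \<odot> qexp_i (y $ phase r)"
    unfolding loop_partial_def
    by (simp add: scaleR_sum_left sum.distrib qmult.sum_left qmult.add_left qmult.scaleR_left
        scaleR_add_right)
  moreover have "(\<Sum>j\<in>UNIV. a j * axis j 1 $ m) = a m" for m
    by (simp add: axis_def if_distrib[of "\<lambda>z. _ * z"] cong: if_cong)
  ultimately show ?thesis by (simp only:)
qed

text \<open>A vanishing combination of the twelve mixed derivatives has one quaternionic component for each \<open>r\<close>.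
Collecting the coefficients of the rotation by \<open>y\<^sub>r\<close> and of \<open>t\<close> into the tangent vectors \<open>A r\<close> and \<open>B\<close>
leaves one equation per component, multiplied by an invertible phase.\<close>

lemma invertible_mixed_hessian_h34: "invertible_mixed_hessian h34 p"
proof -
  obtain x y where p: "p = (x, y)" by fastforce
  have "basis_family (\<lambda>(i, j). partial_x i (partial_y j h34) p)"
  proof (rule basis_familyI)
    show "CARD(3 \<times> 4) = DIM(quat^3)" by simp
  next
    fix c :: "3 \<times> 4 \<Rightarrow> real" and k :: "3 \<times> 4"
    assume "(\<Sum>k\<in>UNIV. c k *\<^sub>R (case k of (i, j) \<Rightarrow> partial_x i (partial_y j h34) p)) = 0"
    then have "(\<Sum>i\<in>UNIV. \<Sum>j\<in>UNIV. c (i, j) *\<^sub>R (\<chi> r. phi_partial i x \<odot> loop_partial j r y)) = 0"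
      unfolding sum.cartesian_product UNIV_Times_UNIV
      by (simp add: p mixed_partial_h34 case_prod_unfold)
    then have comb: "(\<Sum>i\<in>UNIV. \<Sum>j\<in>UNIV. c (i, j) *\<^sub>R (phi_partial i x \<odot> loop_partial j r y)) = 0" for r
      by (simp add: vec_eq_iff)
    define A where "A = (\<lambda>r. \<Sum>i\<in>UNIV. c (i, phase r) *\<^sub>R phi_partial i x)"
    define B where "B = (\<Sum>i\<in>UNIV. c (i, 4) *\<^sub>R phi_partial i x)"
    have eqs: "B \<odot> v_deriv r (y$4) + A r \<odot> (v_loop r (y$4) \<odot> qi) = 0" for r
    proof -
      have "0 = (\<Sum>i\<in>UNIV. phi_partial i x \<odot> (\<Sum>j\<in>UNIV. c (i, j) *\<^sub>R loop_partial j r y))"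
        using comb[of r] by (simp add: qmult.sum_right qmult.scaleR_right)
      also have "\<dots> = (B \<odot> v_deriv r (y$4) + A r \<odot> (v_loop r (y$4) \<odot> qi)) \<odot> qexp_i (y $ phase r)"
        unfolding sum_loop_partial A_def B_def
        by (simp add: qmult.sum_left qmult.add_left qmult.add_right qmult.scaleR_left
            qmult.scaleR_right qmult_assoc sum.distrib)
      finally have "(B \<odot> v_deriv r (y$4) + A r \<odot> (v_loop r (y$4) \<odot> qi)) \<odot>
          (qexp_i (y $ phase r) \<odot> qexp_i (- (y $ phase r))) = 0"
        by (metis qmult_assoc qmult.zero_left)
      then show ?thesis by (simp add: qexp_i_inverse qmult_quat_of_real)
    qed
    have "B \<bullet> phi_normal x = 0" "A r \<bullet> phi_normal x = 0" for r
      by (simp_all add: A_def B_def inner_sum_left phi_partial_normal)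
    note trivial = tangent_equations_trivial[OF phi_normal_nonzero this eqs]
    have "c (i, phase r) = 0" "c (i, 4) = 0" for i r
      using phi_immersion[OF trivial(1)[unfolded B_def]] phi_immersion[OF trivial(2)[unfolded A_def]]
      by blast+
    moreover obtain i j where "k = (i, j)" by fastforce
    ultimately show "c k = 0"
      using exhaust_4[of j] by (metis phase_simps(1,2,3))
  qed
  then show ?thesis unfolding invertible_mixed_hessian_def .
qed

section \<open>Periodicity and smoothness\<close>

lemma sin_cos_plus_2pi_int:
  "sin (x + 2 * pi * of_int n) = sin x" "cos (x + 2 * pi * of_int n) = cos x"
  by (simp_all add: sin_add cos_add)

lemma v_loop_periodic: "v_loop r (t + 2 * pi * of_int n) = v_loop r t"
proof -
  have multiples: "2 * (t + 2 * pi * of_int n) = 2 * t + 2 * pi * of_int (2 * n)"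
    "3 * (t + 2 * pi * of_int n) = 3 * t + 2 * pi * of_int (3 * n)"
    by (simp_all add: algebra_simps)
  have "Gamma_rows (t + 2 * pi * of_int n) = Gamma_rows t"
    unfolding Gamma_rows_def by (simp only: multiples sin_cos_plus_2pi_int)
  then show ?thesis by (simp add: v_loop_def F_loop_def)
qed

lemma torus_periodic_h34: "torus_periodic h34"
  unfolding torus_periodic_def h34_eq
  by (simp add: v_loop_periodic phi_def qexp_i_def sin_cos_plus_2pi_int)

lemma smooth_h34: "smooth h34"
proof (rule smooth_componentwise)
  fix r
  have "smooth (\<lambda>p. phi (fst p) \<odot> (v_loop r (snd p $ 4) \<odot> qexp_i (snd p $ phase r)))"
    by (intro smooth_intros smooth_phi smooth_v_loop)
  moreover have "h34 p $ r = phi (fst p) \<odot> (v_loop r (snd p $ 4) \<odot> qexp_i (snd p $ phase r))" for p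
    by (cases p) (simp add: h34_eq)
  ultimately show "smooth (\<lambda>p. h34 p $ r)" by simp
qed

theorem proposition12: "h34 \<in> P_maps"
  by (simp add: P_maps_def torus_periodic_h34 smooth_h34 invertible_mixed_hessian_h34)

end
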